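(* Let $\kappa$ be a field, $G$ an infinite group having a non-trivial element of finite order, and $\sigma\in pm(G)$ an idempotent factor set, i.e. $\sigma(g,h)\in\{0,1\}$ for all $g,h\in G$. Let $\operatorname{Null}(\sigma)=\{(x,y)\in G\times G:\sigma(x,y)=0\}$. If $|\operatorname{Null}(\sigma)|<|G|$, then the spectral partial action $\hat\theta$ of $G$ on $\Omega_\sigma$ is topologically free.
   Context: A partial projective $\sigma$-representation of $G$ in a unital (associative) $\kappa$-algebra $R$ (with $1_R\neq 0$) is a map $\Gamma:G\to R$ for which there is a function $\sigma:G\times G\to\kappa$ (called the factor set) such that for all $g,h\in G$: (i) if $\sigma(g,h)=0$ then $\Gamma(g^{-1})\Gamma(gh)=0$ and $\Gamma(gh)\Gamma(h^{-1})=0$; (ii) if $\Gamma(g)\Gamma(h)=0$ then $\sigma(g,h)=0$; (iii) $\Gamma(1_G)=1_R$; (iv) $\Gamma(g^{-1})\Gamma(g)\Gamma(h)=\sigma(g,h)\Gamma(g^{-1})\Gamma(gh)$; (v) $\Gamma(g)\Gamma(h)\Gamma(h^{-1})=\sigma(g,h)\Gamma(gh)\Gamma(h^{-1})$. The set of all factor sets of $G$ (over all such $R$ and $\Gamma$) is $pm(G)$. Let $\Omega=\{\xi\subseteq G:1\in\xi\}$, identified with $\prod_{g\in G\setminus\{1\}}\{0,1\}$ and given the product topology. The $\sigma$-prohibitions of type I are the sets $\{h,hg,hgs\}$ with $h,g,s\in G$ and $\sigma(g,s)=0$; those of type II are the sets $\{h,hg,hgs,hgst\}$ with $h,g,s,t\in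 G$ and $\sigma(g,st)\sigma(s,t)\neq\sigma(g,s)\sigma(gs,t)$. $\mathcal{P}_\sigma$ is the set of all $\sigma$-prohibitions, and $\Omega_\sigma=\{\xi\in\Omega: V\nsubseteq\xi\text{ for all }V\in\mathcal{P}_\sigma\}$ with the subspace topology. The spectral partial action $\hat\theta$ of $G$ on $\Omega_\sigma$ is given by the clopen sets $\hat D_g=\{\xi\in\Omega_\sigma:g\in\xi\}$ and the homeomorphisms $\hat\theta_g:\hat D_{g^{-1}}\to\hat D_g$, $\hat\theta_g(\xi)=g\xi$. A topological partial action $(\{X_g\},\{\theta_g:X_{g^{-1}}\to X_g\})$ of $G$ on a space $X$ is topologically free if for every $g\neq1_G$ the set $\{x\in X_{g^{-1}}:\theta_g(x)=x\}$ has empty interior. *)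

theory Defs
  imports
    "HOL-Algebra.Module"
    "HOL-Algebra.Coset"
    "HOL-Library.Equipollence"
    "HOL-Analysis.Function_Topology"
begin

section \<open>Partial projective representations and factor sets\<close>

text \<open>The locale \<^locale>\<open>algebra\<close> of the library is restricted to commutative algebras; the
  algebras needed here are associative and unital, but not necessarily commutative.\<close>

definition unital_algebra :: "('k, 'n) ring_scheme \<Rightarrow> ('k, 'r, 'o) module_scheme \<Rightarrow> bool"
  where
  "unital_algebra K R \<longleftrightarrow>
     field K \<and> ring R \<and> Module.module K R \<and>
     (\<forall>a\<in>carrier K. \<forall>x\<in>carrier R. \<forall>y\<in>carrier R.
        (a \<odot>\<^bsub>R\<^esub> x) \<otimes>\<^bsub>R\<^esub> y = a \<odot>\<^bsub>R\<^esub> (x \<otimes>\<^bsub>R\<^esub> y) \<and>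
        x \<otimes>\<^bsub>R\<^esub> (a \<odot>\<^bsub>R\<^esub> y) = a \<odot>\<^bsub>R\<^esub> (x \<otimes>\<^bsub>R\<^esub> y)) \<and>
     \<one>\<^bsub>R\<^esub> \<noteq> \<zero>\<^bsub>R\<^esub>"

definition partial_projective_rep ::
  "('g, 'm) monoid_scheme \<Rightarrow> ('k, 'n) ring_scheme \<Rightarrow> ('k, 'r, 'o) module_scheme \<Rightarrow>
    ('g \<Rightarrow> 'g \<Rightarrow> 'k) \<Rightarrow> ('g \<Rightarrow> 'r) \<Rightarrow> bool"
  where
  "partial_projective_rep G K R \<sigma> \<Gamma> \<longleftrightarrow>
     \<sigma> \<in> carrier G \<rightarrow> carrier G \<rightarrow> carrier K \<and>
     \<Gamma> \<in> carrier G \<rightarrow> carrier R \<and>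
     \<Gamma> \<one>\<^bsub>G\<^esub> = \<one>\<^bsub>R\<^esub> \<and>
     (\<forall>g\<in>carrier G. \<forall>h\<in>carrier G.
        (\<sigma> g h = \<zero>\<^bsub>K\<^esub> \<longrightarrow>
           \<Gamma> (inv\<^bsub>G\<^esub> g) \<otimes>\<^bsub>R\<^esub> \<Gamma> (g \<otimes>\<^bsub>G\<^esub> h) = \<zero>\<^bsub>R\<^esub> \<and>
           \<Gamma> (g \<otimes>\<^bsub>G\<^esub> h) \<otimes>\<^bsub>R\<^esub> \<Gamma> (inv\<^bsub>G\<^esub> h) = \<zero>\<^bsub>R\<^esub>) \<and>
        (\<Gamma> g \<otimes>\<^bsub>R\<^esub> \<Gamma> h = \<zero>\<^bsub>R\<^esub> \<longrightarrow> \<sigma> g h = \<zero>\<^bsub>K\<^esub>) \<and>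
        \<Gamma> (inv\<^bsub>G\<^esub> g) \<otimes>\<^bsub>R\<^esub> \<Gamma> g \<otimes>\<^bsub>R\<^esub> \<Gamma> h =
          \<sigma> g h \<odot>\<^bsub>R\<^esub> (\<Gamma> (inv\<^bsub>G\<^esub> g) \<otimes>\<^bsub>R\<^esub> \<Gamma> (g \<otimes>\<^bsub>G\<^esub> h)) \<and>
        \<Gamma> g \<otimes>\<^bsub>R\<^esub> \<Gamma> h \<otimes>\<^bsub>R\<^esub> \<Gamma> (inv\<^bsub>G\<^esub> h) =
          \<sigma> g h \<odot>\<^bsub>R\<^esub> (\<Gamma> (g \<otimes>\<^bsub>G\<^esub> h) \<otimes>\<^bsub>R\<^esub> \<Gamma> (inv\<^bsub>G\<^esub> h)))"

text \<open>A quantifier inside HOL cannot range over algebras of all types, so the type \<open>'r\<close> in which the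
  carriers of the algebras live is a parameter. A theorem that assumes \<open>\<sigma> \<in> pm TYPE('r) G K\<close> with
  a free type variable \<open>'r\<close> covers the factor sets over all algebras.

  Only the values of a factor set on \<open>carrier G\<close> matter; elements of \<open>pm\<close> are arbitrary
  elsewhere.\<close>

definition pm ::
  "'r itself \<Rightarrow> ('g, 'm) monoid_scheme \<Rightarrow> ('k, 'n) ring_scheme \<Rightarrow> ('g \<Rightarrow> 'g \<Rightarrow> 'k) set"
  where
  "pm _ G K = {\<sigma>. \<exists>(R :: ('k, 'r) module) \<Gamma>.
     unital_algebra K R \<and> partial_projective_rep G K R \<sigma> \<Gamma>}"

definition idempotent_on ::
  "('g, 'm) monoid_scheme \<Rightarrow> ('k, 'n) ring_scheme \<Rightarrow> ('g \<Rightarrow> 'g \<Rightarrow> 'k) \<Rightarrow> bool"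
  where
  "idempotent_on G K \<sigma> \<longleftrightarrow> (\<forall>g\<in>carrier G. \<forall>h\<in>carrier G. \<sigma> g h \<in> {\<zero>\<^bsub>K\<^esub>, \<one>\<^bsub>K\<^esub>})"

definition Null ::
  "('g, 'm) monoid_scheme \<Rightarrow> ('k, 'n) ring_scheme \<Rightarrow> ('g \<Rightarrow> 'g \<Rightarrow> 'k) \<Rightarrow> ('g \<times> 'g) set"
  where
  "Null G K \<sigma> = {(x, y) \<in> carrier G \<times> carrier G. \<sigma> x y = \<zero>\<^bsub>K\<^esub>}"


section \<open>Topological partial actions\<close>

text \<open>The domains are \<open>D g\<close>, and \<open>\<theta> g\<close> is only meaningful as a map from \<open>D (inv g)\<close> to \<open>D g\<close>.\<close>

definition topological_partial_action ::
  "('g, 'm) monoid_scheme \<Rightarrow> 'x topology \<Rightarrow> ('g \<Rightarrow> 'x set) \<Rightarrow> ('g \<Rightarrow> 'x \<Rightarrow> 'x) \<Rightarrow> bool"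
  where
  "topological_partial_action G X D \<theta> \<longleftrightarrow>
     (\<forall>g\<in>carrier G. openin X (D g)) \<and>
     (\<forall>g\<in>carrier G.
        homeomorphic_map (subtopology X (D (inv\<^bsub>G\<^esub> g))) (subtopology X (D g)) (\<theta> g)) \<and>
     D \<one>\<^bsub>G\<^esub> = topspace X \<and>
     (\<forall>x\<in>topspace X. \<theta> \<one>\<^bsub>G\<^esub> x = x) \<and>
     (\<forall>g\<in>carrier G. \<forall>h\<in>carrier G. \<theta> g ` (D (inv\<^bsub>G\<^esub> g) \<inter> D h) = D g \<inter> D (g \<otimes>\<^bsub>G\<^esub> h)) \<and>
     (\<forall>g\<in>carrier G. \<forall>h\<in>carrier G. \<forall>x\<in>D (inv\<^bsub>G\<^esub> h) \<inter> D (inv\<^bsub>G\<^esub> (g \<otimes>\<^bsub>G\<^esub> h)).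
        \<theta> g (\<theta> h x) = \<theta> (g \<otimes>\<^bsub>G\<^esub> h) x)"

definition topologically_free ::
  "('g, 'm) monoid_scheme \<Rightarrow> 'x topology \<Rightarrow> ('g \<Rightarrow> 'x set) \<Rightarrow> ('g \<Rightarrow> 'x \<Rightarrow> 'x) \<Rightarrow> bool"
  where
  "topologically_free G X D \<theta> \<longleftrightarrow>
     topological_partial_action G X D \<theta> \<and>
     (\<forall>g\<in>carrier G - {\<one>\<^bsub>G\<^esub>}. X interior_of {x \<in> D (inv\<^bsub>G\<^esub> g). \<theta> g x = x} = {})"


section \<open>The spectral partial action\<close>

definition Omega :: "('g, 'm) monoid_scheme \<Rightarrow> 'g set set"
  where "Omega G = {\<xi>. \<xi> \<subseteq> carrier G \<and> \<one>\<^bsub>G\<^esub> \<in> \<xi>}"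

text \<open>Restricted indicator functions identify \<open>Omega G\<close> with \<open>\<Pi>\<^sub>E g\<in>carrier G - {\<one>}. {False, True}\<close>;
  the topology is the product topology transported along this bijection.\<close>

definition Omega_topology :: "('g, 'm) monoid_scheme \<Rightarrow> 'g set topology"
  where
  "Omega_topology G =
     pullback_topology (Omega G) (\<lambda>\<xi>. \<lambda>g\<in>carrier G - {\<one>\<^bsub>G\<^esub>}. g \<in> \<xi>)
       (product_topology (\<lambda>_. discrete_topology {False, True}) (carrier G - {\<one>\<^bsub>G\<^esub>}))"

definition prohibitions_I ::
  "('g, 'm) monoid_scheme \<Rightarrow> ('k, 'n) ring_scheme \<Rightarrow> ('g \<Rightarrow> 'g \<Rightarrow> 'k) \<Rightarrow> 'g set set"
  where
  "prohibitions_I G K \<sigma> =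
     {{h, h \<otimes>\<^bsub>G\<^esub> g, h \<otimes>\<^bsub>G\<^esub> g \<otimes>\<^bsub>G\<^esub> s} | h g s.
        h \<in> carrier G \<and> g \<in> carrier G \<and> s \<in> carrier G \<and> \<sigma> g s = \<zero>\<^bsub>K\<^esub>}"

definition prohibitions_II ::
  "('g, 'm) monoid_scheme \<Rightarrow> ('k, 'n) ring_scheme \<Rightarrow> ('g \<Rightarrow> 'g \<Rightarrow> 'k) \<Rightarrow> 'g set set"
  where
  "prohibitions_II G K \<sigma> =
     {{h, h \<otimes>\<^bsub>G\<^esub> g, h \<otimes>\<^bsub>G\<^esub> g \<otimes>\<^bsub>G\<^esub> s, h \<otimes>\<^bsub>G\<^esub> g \<otimes>\<^bsub>G\<^esub> s \<otimes>\<^bsub>G\<^esub> t} | h g s t.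
        h \<in> carrier G \<and> g \<in> carrier G \<and> s \<in> carrier G \<and> t \<in> carrier G \<and>
        \<sigma> g (s \<otimes>\<^bsub>G\<^esub> t) \<otimes>\<^bsub>K\<^esub> \<sigma> s t \<noteq> \<sigma> g s \<otimes>\<^bsub>K\<^esub> \<sigma> (g \<otimes>\<^bsub>G\<^esub> s) t}"

definition prohibitions ::
  "('g, 'm) monoid_scheme \<Rightarrow> ('k, 'n) ring_scheme \<Rightarrow> ('g \<Rightarrow> 'g \<Rightarrow> 'k) \<Rightarrow> 'g set set"
  where "prohibitions G K \<sigma> = prohibitions_I G K \<sigma> \<union> prohibitions_II G K \<sigma>"

definition Omega_sigma ::
  "('g, 'm) monoid_scheme \<Rightarrow> ('k, 'n) ring_scheme \<Rightarrow> ('g \<Rightarrow> 'g \<Rightarrow> 'k) \<Rightarrow> 'g set set"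
  where "Omega_sigma G K \<sigma> = {\<xi> \<in> Omega G. \<forall>V\<in>prohibitions G K \<sigma>. \<not> V \<subseteq> \<xi>}"

definition Omega_sigma_topology ::
  "('g, 'm) monoid_scheme \<Rightarrow> ('k, 'n) ring_scheme \<Rightarrow> ('g \<Rightarrow> 'g \<Rightarrow> 'k) \<Rightarrow> 'g set topology"
  where "Omega_sigma_topology G K \<sigma> = subtopology (Omega_topology G) (Omega_sigma G K \<sigma>)"

definition spectral_domain ::
  "('g, 'm) monoid_scheme \<Rightarrow> ('k, 'n) ring_scheme \<Rightarrow> ('g \<Rightarrow> 'g \<Rightarrow> 'k) \<Rightarrow> 'g \<Rightarrow> 'g set set"
  where "spectral_domain G K \<sigma> g = {\<xi> \<in> Omega_sigma G K \<sigma>. g \<in> \<xi>}"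

definition spectral_map :: "('g, 'm) monoid_scheme \<Rightarrow> 'g \<Rightarrow> 'g set \<Rightarrow> 'g set"
  where "spectral_map G g \<xi> = g <#\<^bsub>G\<^esub> \<xi>"


subsection \<open>The spectral partial action is a topological partial action\<close>

lemma topspace_Omega_topology: "topspace (Omega_topology G) = Omega G"
  by (auto simp: Omega_topology_def topspace_pullback_topology)

lemma topspace_Omega_sigma_topology: "topspace (Omega_sigma_topology G K \<sigma>) = Omega_sigma G K \<sigma>"
  by (auto simp: Omega_sigma_topology_def topspace_Omega_topology Omega_sigma_def)

lemma continuous_map_mem_Omega:
  assumes "k \<in> carrier G"
  shows "continuous_map (Omega_topology G) (discrete_topology {False, True}) (\<lambda>\<xi>. k \<in> \<xi>)"
proof (cases "k = \<one>\<^bsub>G\<^esub>")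
  case True
  have "continuous_map (Omega_topology G) (discrete_topology {False, True}) (\<lambda>\<xi>. True)"
    by simp
  then show ?thesis
    by (rule continuous_map_eq) (auto simp: topspace_Omega_topology Omega_def True)
next
  case False
  have "continuous_map
      (product_topology (\<lambda>_. discrete_topology {False, True}) (carrier G - {\<one>\<^bsub>G\<^esub>}))
      (discrete_topology {False, True}) (\<lambda>x. x k)"
    using assms False by (intro continuous_map_product_projection) auto
  from continuous_map_pullback[OF this, of "Omega G" "\<lambda>\<xi>. \<lambda>g\<in>carrier G - {\<one>\<^bsub>G\<^esub>}. g \<in> \<xi>"]
  show ?thesis
    using assms False by (simp add: Omega_topology_def comp_def)
qed

lemma openin_spectral_domain:
  assumes "k \<in> carrier G"
  shows "openin (Omega_sigma_topology G K \<sigma>) (spectral_domain G K \<sigma> k)"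
proof -
  have "openin (Omega_topology G) {\<xi> \<in> topspace (Omega_topology G). (k \<in> \<xi>) \<in> {True}}"
    by (rule openin_continuous_map_preimage[OF continuous_map_mem_Omega[OF assms]]) auto
  then show ?thesis
    unfolding Omega_sigma_topology_def openin_subtopology
    by (intro exI conjI) (auto simp: spectral_domain_def topspace_Omega_topology Omega_sigma_def)
qed

context group
begin

lemma mem_l_coset_iff:
  assumes "g \<in> carrier G" "k \<in> carrier G" "\<xi> \<subseteq> carrier G"
  shows "k \<in> g <# \<xi> \<longleftrightarrow> inv g \<otimes> k \<in> \<xi>"
proof
  assume "k \<in> g <# \<xi>"
  then obtain x where "x \<in> \<xi>" "k = g \<otimes> x"
    by (auto simp: l_coset_def)
  then show "inv g \<otimes> k \<in> \<xi>"
    using assms by (metis inv_solve_left m_closed subsetD)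
next
  assume *: "inv g \<otimes> k \<in> \<xi>"
  have "k = g \<otimes> (inv g \<otimes> k)"
    using assms by (simp add: m_assoc[symmetric])
  with * show "k \<in> g <# \<xi>"
    by (auto simp: l_coset_def)
qed

lemma l_coset_prohibition:
  assumes "a \<in> carrier G" "V \<in> prohibitions G K \<sigma>"
  shows "a <# V \<in> prohibitions G K \<sigma>"
  using assms(2) unfolding prohibitions_def
proof
  assume "V \<in> prohibitions_I G K \<sigma>"
  then obtain h g s where *: "V = {h, h \<otimes> g, h \<otimes> g \<otimes> s}" "h \<in> carrier G" "g \<in> carrier G"
    "s \<in> carrier G" "\<sigma> g s = \<zero>\<^bsub>K\<^esub>"
    unfolding prohibitions_I_def by blast
  then have "a <# V = {a \<otimes> h, a \<otimes> h \<otimes> g, a \<otimes> h \<otimes> g \<otimes> s}"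
    using assms(1) by (auto simp: l_coset_def m_assoc)
  moreover have "a \<otimes> h \<in> carrier G"
    using * assms(1) by simp
  ultimately have "a <# V \<in> prohibitions_I G K \<sigma>"
    unfolding prohibitions_I_def using * by blast
  then show "a <# V \<in> prohibitions_I G K \<sigma> \<union> prohibitions_II G K \<sigma>" ..
next
  assume "V \<in> prohibitions_II G K \<sigma>"
  then obtain h g s t where *: "V = {h, h \<otimes> g, h \<otimes> g \<otimes> s, h \<otimes> g \<otimes> s \<otimes> t}" "h \<in> carrier G"
    "g \<in> carrier G" "s \<in> carrier G" "t \<in> carrier G"
    "\<sigma> g (s \<otimes> t) \<otimes>\<^bsub>K\<^esub> \<sigma> s t \<noteq> \<sigma> g s \<otimes>\<^bsub>K\<^esub> \<sigma> (g \<otimes> s) t"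
    unfolding prohibitions_II_def by blast
  then have "a <# V = {a \<otimes> h, a \<otimes> h \<otimes> g, a \<otimes> h \<otimes> g \<otimes> s, a \<otimes> h \<otimes> g \<otimes> s \<otimes> t}"
    using assms(1) by (auto simp: l_coset_def m_assoc)
  moreover have "a \<otimes> h \<in> carrier G"
    using * assms(1) by simp
  ultimately have "a <# V \<in> prohibitions_II G K \<sigma>"
    unfolding prohibitions_II_def using * by blast
  then show "a <# V \<in> prohibitions_I G K \<sigma> \<union> prohibitions_II G K \<sigma>" ..
qed

lemma l_coset_inv_l_coset:
  assumes "g \<in> carrier G" "\<xi> \<subseteq> carrier G"
  shows "inv g <# (g <# \<xi>) = \<xi>"
  using assms by (simp add: lcos_m_assoc lcos_mult_one)

lemma spectral_map_in_Omega_sigma: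
  assumes g: "g \<in> carrier G" and \<xi>: "\<xi> \<in> spectral_domain G K \<sigma> (inv g)"
  shows "g <# \<xi> \<in> spectral_domain G K \<sigma> g"
proof -
  have sub: "\<xi> \<subseteq> carrier G" and "\<one> \<in> \<xi>" and "inv g \<in> \<xi>"
    and free: "\<And>V. V \<in> prohibitions G K \<sigma> \<Longrightarrow> \<not> V \<subseteq> \<xi>"
    using \<xi> by (auto simp: spectral_domain_def Omega_sigma_def Omega_def)
  have "\<not> V \<subseteq> g <# \<xi>" if "V \<in> prohibitions G K \<sigma>" for V
  proof
    assume "V \<subseteq> g <# \<xi>"
    then have "inv g <# V \<subseteq> inv g <# (g <# \<xi>)"
      by (auto simp: l_coset_def)
    then have "inv g <# V \<subseteq> \<xi>"
      using g sub by (simp add: l_coset_inv_l_coset)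
    then show False
      using free[OF l_coset_prohibition[OF _ that, of "inv g"]] g by simp
  qed
  moreover have "g <# \<xi> \<subseteq> carrier G"
    using g sub by (rule l_coset_subset_G[rotated])
  moreover have "\<one> \<in> g <# \<xi>" "g \<in> g <# \<xi>"
    using g sub \<open>\<one> \<in> \<xi>\<close> \<open>inv g \<in> \<xi>\<close> by (simp_all add: mem_l_coset_iff)
  ultimately show ?thesis
    by (simp add: spectral_domain_def Omega_sigma_def Omega_def)
qed

lemma continuous_map_spectral_map:
  assumes g: "g \<in> carrier G"
  shows "continuous_map
     (subtopology (Omega_sigma_topology G K \<sigma>) (spectral_domain G K \<sigma> (inv g)))
     (subtopology (Omega_sigma_topology G K \<sigma>) (spectral_domain G K \<sigma> g)) (spectral_map G g)"
proof -
  let ?D = "spectral_domain G K \<sigma>"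
  let ?X = "subtopology (Omega_sigma_topology G K \<sigma>) (?D (inv g))"
  let ?f = "\<lambda>\<xi>. \<lambda>g\<in>carrier G - {\<one>}. g \<in> \<xi>"
  have X: "?X = subtopology (Omega_topology G) (?D (inv g))"
    unfolding Omega_sigma_topology_def subtopology_subtopology
    by (rule arg_cong[where f = "subtopology _"]) (auto simp: spectral_domain_def)
  have top: "topspace ?X = ?D (inv g)"
    by (auto simp: topspace_Omega_sigma_topology spectral_domain_def)
  have coord: "continuous_map ?X (discrete_topology {False, True}) (\<lambda>\<xi>. k \<in> g <# \<xi>)"
    if k: "k \<in> carrier G" for k
  proof (rule continuous_map_eq)
    show "continuous_map ?X (discrete_topology {False, True}) (\<lambda>\<xi>. inv g \<otimes> k \<in> \<xi>)"
      unfolding X using g k by (intro continuous_map_from_subtopology continuous_map_mem_Omega) simp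
    show "(inv g \<otimes> k \<in> \<xi>) = (k \<in> g <# \<xi>)" if "\<xi> \<in> topspace ?X" for \<xi>
      using that g k unfolding top
      by (subst mem_l_coset_iff) (auto simp: spectral_domain_def Omega_sigma_def Omega_def)
  qed
  have "continuous_map ?X (product_topology (\<lambda>_. discrete_topology {False, True}) (carrier G - {\<one>}))
      (?f \<circ> spectral_map G g)"
    by (subst continuous_map_componentwise) (auto simp: spectral_map_def intro: coord)
  then have "continuous_map ?X (Omega_topology G) (spectral_map G g)"
    unfolding Omega_topology_def
  proof (rule continuous_map_pullback')
    show "topspace ?X \<subseteq> spectral_map G g -` Omega G"
    proof (intro subsetI vimageI2)
      fix \<xi> assume "\<xi> \<in> topspace ?X"
      then have "g <# \<xi> \<in> ?D g"
        using spectral_map_in_Omega_sigma[OF g] unfolding top by blast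
      then show "spectral_map G g \<xi> \<in> Omega G"
        by (simp add: spectral_map_def spectral_domain_def Omega_sigma_def)
    qed
  qed
  then show ?thesis
    using spectral_map_in_Omega_sigma[OF g, of _ K \<sigma>] top
    by (auto simp: continuous_map_in_subtopology Omega_sigma_topology_def spectral_map_def
        spectral_domain_def)
qed

lemma topological_partial_action_spectral:
  "topological_partial_action G (Omega_sigma_topology G K \<sigma>) (spectral_domain G K \<sigma>)
     (spectral_map G)"
  unfolding topological_partial_action_def
proof (intro conjI ballI)
  let ?D = "spectral_domain G K \<sigma>"
  have sub: "\<xi> \<subseteq> carrier G" if "\<xi> \<in> ?D g" for \<xi> g
    using that by (auto simp: spectral_domain_def Omega_sigma_def Omega_def)
  show "openin (Omega_sigma_topology G K \<sigma>) (?D g)" if "g \<in> carrier G" for g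
    using that by (rule openin_spectral_domain)
  show "homeomorphic_map (subtopology (Omega_sigma_topology G K \<sigma>) (?D (inv g)))
      (subtopology (Omega_sigma_topology G K \<sigma>) (?D g)) (spectral_map G g)"
    if g: "g \<in> carrier G" for g
    unfolding homeomorphic_map_maps homeomorphic_maps_def
  proof (intro exI[of _ "spectral_map G (inv g)"] conjI ballI)
    show "continuous_map (subtopology (Omega_sigma_topology G K \<sigma>) (?D g))
        (subtopology (Omega_sigma_topology G K \<sigma>) (?D (inv g))) (spectral_map G (inv g))"
      using continuous_map_spectral_map[of "inv g"] g by simp
    show "spectral_map G (inv g) (spectral_map G g \<xi>) = \<xi>"
      if "\<xi> \<in> topspace (subtopology (Omega_sigma_topology G K \<sigma>) (?D (inv g)))" for \<xi>
      using that g sub[of \<xi> "inv g"] by (simp add: spectral_map_def l_coset_inv_l_coset)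
    show "spectral_map G g (spectral_map G (inv g) \<xi>) = \<xi>"
      if "\<xi> \<in> topspace (subtopology (Omega_sigma_topology G K \<sigma>) (?D g))" for \<xi>
      using that g sub[of \<xi> g] l_coset_inv_l_coset[of "inv g" \<xi>]
      by (simp add: spectral_map_def)
  qed (rule continuous_map_spectral_map[OF g])
  show "?D \<one> = topspace (Omega_sigma_topology G K \<sigma>)"
    by (auto simp: topspace_Omega_sigma_topology spectral_domain_def Omega_sigma_def Omega_def)
  show "spectral_map G \<one> \<xi> = \<xi>" if "\<xi> \<in> topspace (Omega_sigma_topology G K \<sigma>)" for \<xi>
    using that
    by (simp add: spectral_map_def lcos_mult_one topspace_Omega_sigma_topology Omega_sigma_def
        Omega_def)
  show "spectral_map G g (spectral_map G h \<xi>) = spectral_map G (g \<otimes> h) \<xi>"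
    if "g \<in> carrier G" "h \<in> carrier G" "\<xi> \<in> ?D (inv h) \<inter> ?D (inv (g \<otimes> h))" for g h \<xi>
    using that sub[of \<xi> "inv h"] by (simp add: spectral_map_def lcos_m_assoc)
  show "spectral_map G g ` (?D (inv g) \<inter> ?D h) = ?D g \<inter> ?D (g \<otimes> h)"
    if g: "g \<in> carrier G" and h: "h \<in> carrier G" for g h
  proof (intro equalityI subsetI)
    fix \<eta> assume "\<eta> \<in> spectral_map G g ` (?D (inv g) \<inter> ?D h)"
    then obtain \<xi> where \<xi>: "\<eta> = g <# \<xi>" "\<xi> \<in> ?D (inv g)" "h \<in> \<xi>"
      by (auto simp: spectral_map_def spectral_domain_def)
    then have "\<eta> \<in> ?D g" "g \<otimes> h \<in> \<eta>"
      using spectral_map_in_Omega_sigma[OF g \<xi>(2)] by (auto simp: l_coset_def)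
    then show "\<eta> \<in> ?D g \<inter> ?D (g \<otimes> h)"
      by (simp add: spectral_domain_def)
  next
    fix \<eta> assume \<eta>: "\<eta> \<in> ?D g \<inter> ?D (g \<otimes> h)"
    have in_D: "inv g <# \<eta> \<in> ?D (inv g)"
      using spectral_map_in_Omega_sigma[of "inv g" \<eta> K \<sigma>] \<eta> g by simp
    have "inv g \<otimes> (g \<otimes> h) \<in> inv g <# \<eta>"
      using \<eta> by (auto simp: l_coset_def spectral_domain_def)
    then have "h \<in> inv g <# \<eta>"
      using g h by (simp add: m_assoc[symmetric])
    with in_D have "inv g <# \<eta> \<in> ?D (inv g) \<inter> ?D h"
      by (simp add: spectral_domain_def)
    moreover have "\<eta> = spectral_map G g (inv g <# \<eta>)"
      using l_coset_inv_l_coset[of "inv g" \<eta>] \<eta> g sub[of \<eta> g] by (simp add: spectral_map_def)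
    ultimately show "\<eta> \<in> spectral_map G g ` (?D (inv g) \<inter> ?D h)"
      by blast
  qed
qed

end

end

(* A basic neighbourhood of a point constrains only finitely many elements of G, so any nonempty open set
   contains a finite member A of Omega_sigma. Adjoining a single element h to A creates a
   prohibition only if h is a translate, by an element of A, of a product determined by a pair in
   Null; since |Null| < |G| some unconstrained h avoids this, and A and insert h A cannot both be
   fixed by a non-trivial g. *)
theory Submission
  imports Defs
begin

text \<open>For finite \<open>I\<close> the right-hand side is finite. For infinite \<open>I\<close>
  it is a union of |I| many finite sets, hence of cardinality at most |I|, too small for
  \<open>S\<close>.\<close>

lemma not_subset_finite_Un_UN_finite:
  includes cardinal_syntax
  assumes "infinite S" "I \<prec> S" "finite C" "\<And>i. i \<in> I \<Longrightarrow> finite (F i)"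
  shows "\<not> S \<subseteq> C \<union> (\<Union>i\<in>I. F i)"
proof
  assume S: "S \<subseteq> C \<union> (\<Union>i\<in>I. F i)"
  show False
  proof (cases "finite I")
    case True
    then have "finite (C \<union> (\<Union>i\<in>I. F i))"
      using assms by simp
    then show False
      using S \<open>infinite S\<close> finite_subset by blast
  next
    case False
    have small: "|B| \<le>o |I|" if "finite B" for B :: "'a set"
      using card_of_ordLeq_infinite[OF _ False] ordLeq_total that False
      by (meson card_of_Well_order card_of_ordLeq_finite)
    \<comment> \<open>As \<open>I\<close> is nonempty, \<open>C\<close> can be absorbed into each
      member of the family, leaving a single indexed union.\<close>
    have "|C \<union> (\<Union>i\<in>I. F i)| = |\<Union>i\<in>I. C \<union> F i|"
      using False by (intro arg_cong[where f = card_of]) auto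
    also have "\<dots> \<le>o |I|"
      by (rule card_of_UNION_ordLeq_infinite) (use False assms(3,4) small card_of_mono1 in auto)
    finally have "|C \<union> (\<Union>i\<in>I. F i)| \<le>o |I|" .
    then have "C \<union> (\<Union>i\<in>I. F i) \<lesssim> I"
      by (auto simp: lepoll_def simp flip: card_of_ordLeq)
    then have "S \<lesssim> I"
      using S subset_imp_lepoll lepoll_trans by blast
    then show False
      using \<open>I \<prec> S\<close> lesspoll_def lepoll_antisym by blast
  qed
qed

text \<open>\<open>J\<close> collects the coordinates that a basic box around \<xi> inside
  \<open>U\<close> really restricts. The identity is not a coordinate, which is harmless because
  every point contains it.\<close>

lemma openin_Omega_sigma_finite_support:
  assumes "openin (Omega_sigma_topology G K \<sigma>) U" "\<xi> \<in> U"
  obtains J where "finite J"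
    "\<And>\<eta>. \<eta> \<in> Omega_sigma G K \<sigma> \<Longrightarrow> \<eta> \<inter> J = \<xi> \<inter> J \<Longrightarrow> \<eta> \<in> U"
proof -
  let ?I = "carrier G - {\<one>\<^bsub>G\<^esub>}"
  let ?f = "\<lambda>\<xi>. \<lambda>g\<in>?I. g \<in> \<xi>"
  let ?P = "product_topology (\<lambda>_. discrete_topology {False, True}) ?I"
  obtain T where T: "openin ?P T" and U: "U = ?f -` T \<inter> Omega G \<inter> Omega_sigma G K \<sigma>"
    using assms(1)
    by (auto simp: Omega_sigma_topology_def Omega_topology_def openin_subtopology
        openin_pullback_topology)
  have "?f \<xi> \<in> T"
    using \<open>\<xi> \<in> U\<close> U by auto
  with T obtain V where fin: "finite {i \<in> ?I. V i \<noteq> {False, True}}"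
    and V: "?f \<xi> \<in> Pi\<^sub>E ?I V" "Pi\<^sub>E ?I V \<subseteq> T"
    by (auto simp: openin_product_topology_alt)
  define J where "J = {i \<in> ?I. V i \<noteq> {False, True}}"
  show thesis
  proof (rule that[of J])
    show "finite J"
      using fin by (simp add: J_def)
    fix \<eta> assume \<eta>: "\<eta> \<in> Omega_sigma G K \<sigma>" "\<eta> \<inter> J = \<xi> \<inter> J"
    have "(i \<in> \<eta>) \<in> V i" if "i \<in> ?I" for i
    proof (cases "i \<in> J")
      case True
      then have "(i \<in> \<eta>) = (i \<in> \<xi>)"
        using \<eta>(2) by blast
      then show ?thesis
        using V(1) that by (auto simp: PiE_iff)
    next
      case False
      then show ?thesis
        using that by (auto simp: J_def)
    qed
    then have "?f \<eta> \<in> T"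
      using V(2) by (auto simp: PiE_iff subset_iff)
    then show "\<eta> \<in> U"
      using \<eta>(1) by (auto simp: U Omega_sigma_def)
  qed
qed

text \<open>Prohibitions only forbid containing certain sets, so they pass to subsets. This allows a
  point to be replaced by a finite part of it.\<close>

lemma Omega_sigma_subset:
  assumes "\<xi> \<in> Omega_sigma G K \<sigma>" "A \<subseteq> \<xi>" "\<one>\<^bsub>G\<^esub> \<in> A"
  shows "A \<in> Omega_sigma G K \<sigma>"
  using assms unfolding Omega_sigma_def Omega_def by blast

text \<open>Otherwise condition (i) at (1,1) would give 1 = 0 in \<open>R\<close>. This keeps (1,1)
  out of \<open>Null\<close>, the only pair whose triple x, xp, xpq collapses to a single
  point.\<close>

lemma pm_one_one_nonzero:
  fixes K :: "('k, 'n) ring_scheme"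
  assumes "group G" "\<sigma> \<in> pm TYPE('r) G K"
  shows "\<sigma> \<one>\<^bsub>G\<^esub> \<one>\<^bsub>G\<^esub> \<noteq> \<zero>\<^bsub>K\<^esub>"
proof
  interpret group G by fact
  assume *: "\<sigma> \<one>\<^bsub>G\<^esub> \<one>\<^bsub>G\<^esub> = \<zero>\<^bsub>K\<^esub>"
  obtain R :: "('k, 'r) module" and \<Gamma> where R: "unital_algebra K R"
    and \<Gamma>: "partial_projective_rep G K R \<sigma> \<Gamma>"
    using assms(2) unfolding pm_def by blast
  interpret R: ring R
    using R by (simp add: unital_algebra_def)
  have "\<Gamma> (inv\<^bsub>G\<^esub> \<one>\<^bsub>G\<^esub>) \<otimes>\<^bsub>R\<^esub> \<Gamma> (\<one>\<^bsub>G\<^esub> \<otimes>\<^bsub>G\<^esub> \<one>\<^bsub>G\<^esub>) = \<zero>\<^bsub>R\<^esub>" "\<Gamma> \<one>\<^bsub>G\<^esub> = \<one>\<^bsub>R\<^esub>"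
    using \<Gamma> * one_closed unfolding partial_projective_rep_def by blast+
  then have "\<one>\<^bsub>R\<^esub> = \<zero>\<^bsub>R\<^esub>"
    by simp
  then show False
    using R by (simp add: unital_algebra_def)
qed

context group
begin

text \<open>For an idempotent \<open>\<sigma>\<close> one of the four values in the cocycle identity vanishes as soon as the
  identity fails, so each prohibition of type II contains one of type I.\<close>

lemma idempotent_prohibition_cases:
  assumes "field K" "idempotent_on G K \<sigma>" "V \<in> prohibitions G K \<sigma>"
  obtains x p q where "(p, q) \<in> Null G K \<sigma>" "x \<in> carrier G" "{x, x \<otimes> p, x \<otimes> p \<otimes> q} \<subseteq> V"
  using assms(3) unfolding prohibitions_def
proof
  assume "V \<in> prohibitions_I G K \<sigma>"
  then show thesis
    by (auto simp: prohibitions_I_def Null_def intro!: that)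
next
  assume "V \<in> prohibitions_II G K \<sigma>"
  then obtain h g s t where V: "V = {h, h \<otimes> g, h \<otimes> g \<otimes> s, h \<otimes> g \<otimes> s \<otimes> t}"
    and c: "h \<in> carrier G" "g \<in> carrier G" "s \<in> carrier G" "t \<in> carrier G"
    and ne: "\<sigma> g (s \<otimes> t) \<otimes>\<^bsub>K\<^esub> \<sigma> s t \<noteq> \<sigma> g s \<otimes>\<^bsub>K\<^esub> \<sigma> (g \<otimes> s) t"
    unfolding prohibitions_II_def by blast
  interpret K: field K by fact
  have dich: "(a, b) \<in> Null G K \<sigma> \<or> \<sigma> a b = \<one>\<^bsub>K\<^esub>" if "a \<in> carrier G" "b \<in> carrier G" for a b
    using assms(2) that by (auto simp: idempotent_on_def Null_def)
  consider "(g, s \<otimes> t) \<in> Null G K \<sigma>" | "(s, t) \<in> Null G K \<sigma>" | "(g, s) \<in> Null G K \<sigma>"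
    | "(g \<otimes> s, t) \<in> Null G K \<sigma>"
    using dich[of g "s \<otimes> t"] dich[of s t] dich[of g s] dich[of "g \<otimes> s" t] c ne by auto
  then show thesis
  proof cases
    \<comment> \<open>The four cases use the triples that omit, in turn, hgs, h, hgst and hg from h,
      hg, hgs, hgst.\<close>
    case 1
    show ?thesis
      by (rule that[OF 1 c(1)]) (use c V in \<open>simp add: m_assoc\<close>)
  next
    case 2
    show ?thesis
      by (rule that[OF 2, of "h \<otimes> g"]) (use c V in simp_all)
  next
    case 3
    show ?thesis
      by (rule that[OF 3 c(1)]) (use c V in simp)
  next
    case 4
    show ?thesis
      by (rule that[OF 4 c(1)]) (use c V in \<open>simp add: m_assoc\<close>)
  qed
qed

text \<open>The six right factors are the quotients between two different positions of a triple x,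
  xp, xpq, so the set lists the possible values of one entry when another entry lies in
  \<open>A\<close>. It is finite for finite \<open>A\<close>.\<close>

definition null_translates :: "'a set \<Rightarrow> 'a \<times> 'a \<Rightarrow> 'a set" where
  "null_translates A = (\<lambda>(p, q). (\<Union>a\<in>A.
     {a \<otimes> p, a \<otimes> q, a \<otimes> (p \<otimes> q), a \<otimes> inv p, a \<otimes> inv q, a \<otimes> inv (p \<otimes> q)}))"

text \<open>Some entry of the triple is outside \<open>A\<close> and hence equals \<open>h\<close>.
  If no entry were in \<open>A\<close>, all three would equal \<open>h\<close>, and cancellation
  would give p = q = 1. So another entry is in \<open>A\<close>, and \<open>h\<close> is solved for
  from it.\<close>

lemma null_translatesI:
  assumes "x \<in> carrier G" "p \<in> carrier G" "q \<in> carrier G"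
    and "{x, x \<otimes> p, x \<otimes> p \<otimes> q} \<subseteq> insert h A" "\<not> {x, x \<otimes> p, x \<otimes> p \<otimes> q} \<subseteq> A"
    and "p \<noteq> \<one> \<or> q \<noteq> \<one>"
  shows "h \<in> null_translates A (p, q)"
proof -
  let ?y = "x \<otimes> p" and ?z = "x \<otimes> p \<otimes> q"
  have "x \<in> A \<or> ?y \<in> A \<or> ?z \<in> A"
  proof (rule ccontr)
    assume "\<not> ?thesis"
    then have "x = h" "?y = h" "?z = h"
      using assms(4) by auto
    then have "x \<otimes> p = x" "?y \<otimes> q = ?y"
      by auto
    then show False
      using assms(1-3,6) by simp
  qed
  then consider "x \<in> A" "h = ?y" | "x \<in> A" "h = ?z" | "?y \<in> A" "h = x" | "?y \<in> A" "h = ?z"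
    | "?z \<in> A" "h = x" | "?z \<in> A" "h = ?y"
    using assms(4,5) by auto
  then show ?thesis
  proof cases
    case 3
    moreover from this have "h = ?y \<otimes> inv p"
      using assms(1-3) by (simp add: m_assoc)
    ultimately show ?thesis
      unfolding null_translates_def by blast
  next
    case 4
    then show ?thesis
      unfolding null_translates_def by blast
  next
    case 5
    moreover from this have "h = ?z \<otimes> inv (p \<otimes> q)"
      using assms(1-3) by (simp add: m_assoc flip: inv_mult_group)
    ultimately show ?thesis
      unfolding null_translates_def by blast
  next
    case 6
    moreover from this have "h = ?z \<otimes> inv q"
      using assms(1-3) by (simp add: m_assoc)
    ultimately show ?thesis
      unfolding null_translates_def by blast
  qed (use assms(1-3) in \<open>auto simp: null_translates_def m_assoc\<close>)
qed

text \<open>A prohibition inside \<open>insert h A\<close> contains a type I triple for a pair in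
  \<open>Null\<close>. Since \<open>A\<close> contains no such triple, \<open>h\<close> must occur
  in it, which makes \<open>h\<close> an excluded translate.\<close>

lemma extension_in_Omega_sigma:
  assumes "field K" "idempotent_on G K \<sigma>" "\<sigma> \<one> \<one> \<noteq> \<zero>\<^bsub>K\<^esub>"
    and "A \<in> Omega_sigma G K \<sigma>" "h \<in> carrier G"
    and "h \<notin> (\<Union>n\<in>Null G K \<sigma>. null_translates A n)"
  shows "insert h A \<in> Omega_sigma G K \<sigma>"
proof (rule ccontr)
  assume "insert h A \<notin> Omega_sigma G K \<sigma>"
  then obtain V where V: "V \<in> prohibitions G K \<sigma>" "V \<subseteq> insert h A"
    using assms(4,5) by (auto simp: Omega_sigma_def Omega_def)
  obtain x p q where pq: "(p, q) \<in> Null G K \<sigma>" and x: "x \<in> carrier G"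
    and sub: "{x, x \<otimes> p, x \<otimes> p \<otimes> q} \<subseteq> V"
    using idempotent_prohibition_cases[OF assms(1,2) V(1)] .
  have c: "p \<in> carrier G" "q \<in> carrier G" "p \<noteq> \<one> \<or> q \<noteq> \<one>"
    using pq assms(3) by (auto simp: Null_def)
  have "{x, x \<otimes> p, x \<otimes> p \<otimes> q} \<in> prohibitions G K \<sigma>"
    using pq x unfolding prohibitions_def prohibitions_I_def Null_def by blast
  then have "\<not> {x, x \<otimes> p, x \<otimes> p \<otimes> q} \<subseteq> A"
    using assms(4) unfolding Omega_sigma_def by blast
  then have "h \<in> null_translates A (p, q)"
    using null_translatesI[OF x c(1,2) _ _ c(3)] sub V(2) by blast
  then show False
    using assms(6) pq by blast
qed

lemma interior_fixed_points_empty: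
  assumes "field K" "idempotent_on G K \<sigma>" "\<sigma> \<one> \<one> \<noteq> \<zero>\<^bsub>K\<^esub>"
    and "infinite (carrier G)" "Null G K \<sigma> \<prec> carrier G"
    and g: "g \<in> carrier G" "g \<noteq> \<one>"
  shows "Omega_sigma_topology G K \<sigma> interior_of
    {\<xi> \<in> spectral_domain G K \<sigma> (inv g). spectral_map G g \<xi> = \<xi>} = {}"
proof (rule ccontr)
  assume "\<not> ?thesis"
  then obtain U \<xi> where U: "openin (Omega_sigma_topology G K \<sigma>) U" "\<xi> \<in> U"
    and fixed: "\<And>\<eta>. \<eta> \<in> U \<Longrightarrow> g <# \<eta> = \<eta>"
    unfolding interior_of_def spectral_map_def by blast
  have \<xi>: "\<xi> \<in> Omega_sigma G K \<sigma>"
    using openin_subset[OF U(1)] U(2) by (auto simp: topspace_Omega_sigma_topology)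
  then have one: "\<one> \<in> \<xi>"
    by (simp add: Omega_sigma_def Omega_def)
  obtain J where J: "finite J"
    "\<And>\<eta>. \<eta> \<in> Omega_sigma G K \<sigma> \<Longrightarrow> \<eta> \<inter> J = \<xi> \<inter> J \<Longrightarrow> \<eta> \<in> U"
    using openin_Omega_sigma_finite_support[OF U] by blast
  \<comment> \<open>A finite subset of \<xi> that agrees with \<xi> on \<open>J\<close>, and so
    still belongs to \<open>U\<close>.\<close>
  define A where "A = insert \<one> (\<xi> \<inter> J)"
  have A: "A \<in> Omega_sigma G K \<sigma>"
    by (rule Omega_sigma_subset[OF \<xi>]) (use one in \<open>auto simp: A_def\<close>)
  then have A_sub: "A \<subseteq> carrier G"
    by (simp add: Omega_sigma_def Omega_def)
  have gA: "g <# A = A"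
    by (rule fixed, rule J(2)[OF A]) (use one in \<open>auto simp: A_def\<close>)
  \<comment> \<open>Avoiding \<open>insert \<one> J\<close> ensures both that \<open>h\<close> is
    not in \<open>A\<close> and that adding \<open>h\<close> changes nothing on
    \<open>J\<close>.\<close>
  have "\<not> carrier G \<subseteq> insert \<one> J \<union> (\<Union>n\<in>Null G K \<sigma>. null_translates A n)"
    by (rule not_subset_finite_Un_UN_finite)
      (use assms(4,5) J(1) in \<open>auto simp: null_translates_def A_def\<close>)
  then obtain h where h: "h \<in> carrier G" "h \<noteq> \<one>" "h \<notin> J"
    "h \<notin> (\<Union>n\<in>Null G K \<sigma>. null_translates A n)"
    by auto
  have "insert h A \<in> Omega_sigma G K \<sigma>"
    by (rule extension_in_Omega_sigma[OF assms(1-3) A h(1,4)])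
  then have "insert h A \<in> U"
    by (rule J(2)) (use h one in \<open>auto simp: A_def\<close>)
  then have "g \<otimes> h \<in> insert h A"
    using fixed[of "insert h A"] by (auto simp: l_coset_def)
  moreover have "g \<otimes> h \<noteq> h"
    using g h(1) by simp
  \<comment> \<open>The element gh lies in \<open>A\<close>, which equals gA; cancelling g then puts
    \<open>h\<close> itself in \<open>A\<close>.\<close>
  ultimately have "g \<otimes> h \<in> g <# A"
    using gA by simp
  then have "h \<in> A"
    using g(1) h(1) A_sub by (simp add: mem_l_coset_iff flip: m_assoc)
  then show False
    using h by (simp add: A_def)
qed

end

theorem corollary9p14:
  fixes G :: "('g, 'm) monoid_scheme"
    and K :: "('k, 'n) ring_scheme"
    and \<sigma> :: "'g \<Rightarrow> 'g \<Rightarrow> 'k"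
  assumes "field K"
    and "group G"
    and "infinite (carrier G)"
    and "\<exists>x\<in>carrier G. x \<noteq> \<one>\<^bsub>G\<^esub> \<and> (\<exists>n::nat. n > 0 \<and> x [^]\<^bsub>G\<^esub> n = \<one>\<^bsub>G\<^esub>)"
    and "\<sigma> \<in> pm TYPE('r) G K"
    and "idempotent_on G K \<sigma>"
    and "Null G K \<sigma> \<prec> carrier G"
  shows "topologically_free G (Omega_sigma_topology G K \<sigma>)
    (spectral_domain G K \<sigma>) (spectral_map G)"
proof -
  interpret group G by fact
  show ?thesis
    unfolding topologically_free_def
    using topological_partial_action_spectral
      interior_fixed_points_empty[OF assms(1,6) pm_one_one_nonzero[OF assms(2,5)] assms(3,7)]
    by blast
qed

end
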